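(* Let $x_i$ and $y_i$ ($i=1,2,\dots$) be indeterminates, and let $n$ be a positive integer. Then $$\operatorname{Pf}_\lambda\bigl(x_iy_j\bigr)_{1\le i<j\le 2n}=\prod_{i=1}^n x_{2i-1}y_{2i}.$$
   Context: $\lambda$ is an indeterminate. For an array $(A_{ij})_{1\le i<j\le 2n}$ (the strictly upper triangular part of a skew-symmetric matrix of size $2n$), the $\lambda$-Pfaffian is $$\operatorname{Pf}_\lambda(A_{ij})_{1\le i<j\le 2n}=\sum_{m\in\mathcal M([2n])}(-1)^{\mathrm{cross}(m)}\,\lambda^{\mathrm{cross}(m)+\mathrm{nest}(m)}\prod_{i=1}^n A_{m_{2i-1}m_{2i}}.$$ Here $\mathcal M([2n])$ is the set of perfect matchings of $[2n]=\{1,\dots,2n\}$, written $m=((m_1,m_2),\dots,(m_{2n-1},m_{2n}))$ with $m_{2i-1}<m_{2i}$ for all $i$ and $m_1<m_3<\cdots<m_{2n-1}$. $\mathrm{cross}(m)$ is the number of (unordered) pairs of pairs $(a,b),(c,d)$ in $m$ with $a<c<b<d$; $\mathrm{nest}(m)$ is the number of pairs of pairs $(a,b),(c,d)$ in $m$ with $a<c<d<b$. *)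

theory Defs
  imports Main
begin

text \<open>
  A matching is encoded as the set of its pairs, each pair \<open>(a, b)\<close> being oriented so that
  \<open>a < b\<close>. Listing the pairs by increasing first entries turns such a set into a sequence
  \<open>((m_1, m_2), ..., (m_(2n-1), m_(2n)))\<close> with \<open>m_(2i-1) < m_(2i)\<close> and
  \<open>m_1 < m_3 < ... < m_(2n-1)\<close>, and this is a bijection.
\<close>

definition perfect_matchings :: "nat set \<Rightarrow> (nat \<times> nat) set set" where
  "perfect_matchings V =
     {m. (\<forall>(a, b)\<in>m. a \<in> V \<and> b \<in> V \<and> a < b) \<and>
         (\<forall>v\<in>V. \<exists>!p. p \<in> m \<and> (v = fst p \<or> v = snd p))}"

text \<open>
  The inequality \<open>a < c\<close> in the next two definitions selects exactly one of the two orderings of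
  an unordered pair of pairs, so each crossing and each nesting is counted once.
\<close>

definition cross :: "(nat \<times> nat) set \<Rightarrow> nat" where
  "cross m = card {((a, b), (c, d)) | a b c d.
     (a, b) \<in> m \<and> (c, d) \<in> m \<and> a < c \<and> c < b \<and> b < d}"

definition nest :: "(nat \<times> nat) set \<Rightarrow> nat" where
  "nest m = card {((a, b), (c, d)) | a b c d.
     (a, b) \<in> m \<and> (c, d) \<in> m \<and> a < c \<and> c < d \<and> d < b}"

text \<open>
  Only the entries \<open>A i j\<close> with \<open>1 \<le> i < j \<le> 2 * n\<close> enter the value.
\<close>

definition lambda_Pfaffian :: "'a::comm_ring_1 \<Rightarrow> nat \<Rightarrow> (nat \<Rightarrow> nat \<Rightarrow> 'a) \<Rightarrow> 'a" where
  "lambda_Pfaffian l n A =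
     (\<Sum>m\<in>perfect_matchings {1..2 * n}.
        (- 1) ^ cross m * l ^ (cross m + nest m) * (\<Prod>(a, b)\<in>m. A a b))"

lemma finite_perfect_matching:
  assumes "finite V" "m \<in> perfect_matchings V"
  shows "finite m"
proof (rule finite_subset)
  show "m \<subseteq> V \<times> V" using assms(2) by (auto simp: perfect_matchings_def)
qed (use assms(1) in simp)

lemma finite_perfect_matchings:
  assumes "finite V"
  shows "finite (perfect_matchings V)"
proof (rule finite_subset)
  show "perfect_matchings V \<subseteq> Pow (V \<times> V)" by (auto simp: perfect_matchings_def)
qed (use assms in simp)

end

theory Submission
  imports Defs "HOL-Combinatorics.Transposition"
begin

text \<open>
  The product of the entries depends only on the set of openers (first entries) of the matching.
  If \<open>i\<close> and \<open>i + 1\<close> are both openers, exchanging them turns the crossing of their two arcs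
  into a nesting or conversely and leaves every other crossing and nesting in place, so the two
  terms cancel. Choosing the least such \<open>i\<close>, which depends only on the set of openers, makes this
  an involution on all matchings having two consecutive openers. The only other matching
  is \<open>{(1, 2), (3, 4), ..., (2 n - 1, 2 n)}\<close>.
\<close>

section \<open>Exchanging two consecutive openers\<close>

text \<open>Transposing both entries of each pair makes this an involution on all sets of pairs. In
  a perfect matching where \<open>i\<close> and \<open>Suc i\<close> are both openers it moves
  openers only.\<close>

definition swap_openers :: "nat \<Rightarrow> (nat \<times> nat) set \<Rightarrow> (nat \<times> nat) set" where
  "swap_openers i m = map_prod (transpose i (Suc i)) (transpose i (Suc i)) ` m"

definition consecutive_openers :: "(nat \<times> nat) set \<Rightarrow> nat \<Rightarrow> bool" where
  "consecutive_openers m i \<longleftrightarrow> i \<in> fst ` m \<and> Suc i \<in> fst ` m"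

lemma perfect_matching_in_carrier:
  assumes "m \<in> perfect_matchings V" "(a, b) \<in> m"
  shows "a \<in> V" "b \<in> V" "a < b"
  using assms by (auto simp: perfect_matchings_def)

lemma perfect_matching_covers:
  assumes "m \<in> perfect_matchings V" "v \<in> V"
  obtains w where "(v, w) \<in> m" | w where "(w, v) \<in> m"
proof -
  obtain p where "p \<in> m" "v = fst p \<or> v = snd p"
    using assms unfolding perfect_matchings_def by blast
  then show thesis using that by (cases p) auto
qed

text \<open>The uniqueness clause in a form applicable to two given pairs: a vertex they share lies
  in \<open>V\<close> as an endpoint of the first.\<close>

lemma perfect_matching_unique:
  assumes m: "m \<in> perfect_matchings V" and "(a, b) \<in> m" "(c, d) \<in> m"
    and "a = c \<or> a = d \<or> b = c \<or> b = d"
  shows "a = c \<and> b = d"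
proof -
  have uniq: "p = q" if "p \<in> m" "q \<in> m" "v \<in> V" "v = fst p \<or> v = snd p" "v = fst q \<or> v = snd q"
    for p q v
    using m that unfolding perfect_matchings_def by blast
  have V: "a \<in> V" "b \<in> V" using perfect_matching_in_carrier[OF m assms(2)] by auto
  have "(a, b) = (c, d)"
  proof (cases "a = c \<or> a = d")
    case True
    then show ?thesis using uniq[OF assms(2,3) V(1)] by auto
  next
    case False
    then show ?thesis using uniq[OF assms(2,3) V(2)] assms(4) by auto
  qed
  then show ?thesis by simp
qed

text \<open>No number lies strictly between \<open>i\<close> and \<open>Suc i\<close>, so their
  exchange can only disturb the comparison of these two values with each other.\<close>

lemma transpose_Suc_less_iff:
  assumes "\<not> (u = i \<and> v = Suc i)" "\<not> (u = Suc i \<and> v = i)"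
  shows "transpose i (Suc i) u < transpose i (Suc i) v \<longleftrightarrow> u < v"
  using assms by (auto simp: transpose_def)

lemma swap_openers_involutory [simp]: "swap_openers i (swap_openers i m) = m"
  by (simp add: swap_openers_def image_image map_prod_def case_prod_beta)

lemma mem_swap_openers_iff:
  "(a, b) \<in> swap_openers i m \<longleftrightarrow> (transpose i (Suc i) a, transpose i (Suc i) b) \<in> m"
proof
  assume "(transpose i (Suc i) a, transpose i (Suc i) b) \<in> m"
  then have "map_prod (transpose i (Suc i)) (transpose i (Suc i))
      (transpose i (Suc i) a, transpose i (Suc i) b) \<in> swap_openers i m"
    unfolding swap_openers_def by (rule imageI)
  then show "(a, b) \<in> swap_openers i m" by simp
qed (auto simp: swap_openers_def)

context
  fixes V :: "nat set" and m :: "(nat \<times> nat) set" and i :: nat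
  assumes m: "m \<in> perfect_matchings V" and i: "consecutive_openers m i"
begin

text \<open>A closer equal to \<open>i\<close> or \<open>Suc i\<close> would force its arc to be the
  one opening there, an arc with equal endpoints.\<close>

lemma consecutive_openers_not_closers:
  assumes "(a, b) \<in> m"
  shows "b \<noteq> i" "b \<noteq> Suc i"
proof -
  obtain c d where "(i, c) \<in> m" "(Suc i, d) \<in> m"
    using i by (auto simp: consecutive_openers_def)
  moreover have "a < b" using perfect_matching_in_carrier[OF m assms] by auto
  ultimately show "b \<noteq> i" "b \<noteq> Suc i"
    using perfect_matching_unique[OF m assms] by auto
qed

lemma transpose_closer:
  assumes "(a, b) \<in> m"
  shows "transpose i (Suc i) b = b"
  using consecutive_openers_not_closers[OF assms] by (simp add: transpose_def)

lemma openers_swap_openers: "fst ` swap_openers i m = fst ` m"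
proof -
  have "fst ` swap_openers i m = transpose i (Suc i) ` fst ` m"
    by (simp add: swap_openers_def image_image)
  also have "\<dots> = fst ` m"
    using i by (simp add: consecutive_openers_def)
  finally show ?thesis .
qed

lemma closers_swap_openers: "snd ` swap_openers i m = snd ` m"
  by (force simp: swap_openers_def image_image transpose_closer)

text \<open>This keeps the least \<open>i\<close> with consecutive openers the same after the
  exchange, so that repeating the exchange restores the matching.\<close>

lemma consecutive_openers_swap_openers:
  "consecutive_openers (swap_openers i m) = consecutive_openers m"
  by (simp add: consecutive_openers_def openers_swap_openers fun_eq_iff)

lemma swap_openers_perfect_matching: "swap_openers i m \<in> perfect_matchings V"
proof -
  let ?t = "transpose i (Suc i)"
  have iV: "i \<in> V" "Suc i \<in> V"
    using i perfect_matching_in_carrier[OF m] by (auto simp: consecutive_openers_def)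
  have tV: "?t v \<in> V \<longleftrightarrow> v \<in> V" for v
    using iV by (auto simp: transpose_def)
  have carrier: "a \<in> V" "b \<in> V" if "(?t a, ?t b) \<in> m" for a b
    using perfect_matching_in_carrier(1,2)[OF m that] tV by auto
  \<comment> \<open>The order could be reversed only between \<open>i\<close> and
    \<open>Suc i\<close>, but \<open>?t b\<close> is a closer of \<open>m\<close> and hence neither
    of them.\<close>
  have less: "a < b" if "(?t a, ?t b) \<in> m" for a b
  proof -
    have "?t a < ?t b" using perfect_matching_in_carrier[OF m that] by simp
    then show ?thesis
      using consecutive_openers_not_closers[OF that] transpose_Suc_less_iff[of "?t a" i "?t b"]
      by (auto simp: transpose_def split: if_splits)
  qed
  have "\<exists>!p. p \<in> swap_openers i m \<and> (v = fst p \<or> v = snd p)" if "v \<in> V" for v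
  proof -
    \<comment> \<open>The pairs of the image at \<open>v\<close> are the images of the pairs of
      \<open>m\<close> at \<open>?t v\<close>.\<close>
    have tv: "?t v \<in> V" using that tV by simp
    have "\<exists>p. p \<in> swap_openers i m \<and> (v = fst p \<or> v = snd p)"
    proof (rule perfect_matching_covers[OF m tv])
      fix w assume "(?t v, w) \<in> m"
      then have "(v, ?t w) \<in> swap_openers i m" by (simp add: mem_swap_openers_iff)
      then show ?thesis by force
    next
      fix w assume "(w, ?t v) \<in> m"
      then have "(?t w, v) \<in> swap_openers i m" by (simp add: mem_swap_openers_iff)
      then show ?thesis by force
    qed
    moreover have "p = q" if "p \<in> swap_openers i m" "q \<in> swap_openers i m"
      "v = fst p \<or> v = snd p" "v = fst q \<or> v = snd q" for p q
    proof -
      obtain a b c d where pq: "p = (a, b)" "q = (c, d)" by (cases p, cases q) auto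
      have "?t a = ?t c \<and> ?t b = ?t d"
        using that unfolding pq mem_swap_openers_iff
        by (intro perfect_matching_unique[OF m]) auto
      then show ?thesis unfolding pq by (metis transpose_involutory)
    qed
    ultimately show ?thesis by blast
  qed
  then show ?thesis
    using less carrier unfolding perfect_matchings_def mem_Collect_eq
    by (auto simp: mem_swap_openers_iff)
qed

end

section \<open>Change in the numbers of crossings and nestings\<close>

definition crossings :: "(nat \<times> nat) set \<Rightarrow> ((nat \<times> nat) \<times> (nat \<times> nat)) set" where
  "crossings m = {((a, b), (c, d)) | a b c d.
     (a, b) \<in> m \<and> (c, d) \<in> m \<and> a < c \<and> c < b \<and> b < d}"

definition nestings :: "(nat \<times> nat) set \<Rightarrow> ((nat \<times> nat) \<times> (nat \<times> nat)) set" where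
  "nestings m = {((a, b), (c, d)) | a b c d.
     (a, b) \<in> m \<and> (c, d) \<in> m \<and> a < c \<and> c < d \<and> d < b}"

text \<open>The two arcs keep their places. A crossing or nesting lists the smaller opener first, so
  the result is out of order precisely when the openers are \<open>i\<close> and
  \<open>Suc i\<close>; that pair of arcs is treated apart.\<close>

definition swap_pairs ::
  "nat \<Rightarrow> (nat \<times> nat) \<times> (nat \<times> nat) \<Rightarrow> (nat \<times> nat) \<times> (nat \<times> nat)" where
  "swap_pairs i = map_prod (map_prod (transpose i (Suc i)) (transpose i (Suc i)))
                           (map_prod (transpose i (Suc i)) (transpose i (Suc i)))"

lemma swap_pairs_involutory [simp]: "swap_pairs i (swap_pairs i p) = p"
  by (cases p) (auto simp: swap_pairs_def)

text \<open>Closers avoid \<open>i\<close> and \<open>Suc i\<close>, so in the chain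
  \<open>a < c < b < d\<close> only \<open>a < c\<close> could be reversed, and that is exactly the
  excluded case. Nestings behave in the same way.\<close>

lemma swap_pairs_crossings:
  assumes m: "m \<in> perfect_matchings V" and i: "consecutive_openers m i"
    and p: "p \<in> crossings m" "\<not> (fst (fst p) = i \<and> fst (snd p) = Suc i)"
  shows "swap_pairs i p \<in> crossings (swap_openers i m)"
proof -
  obtain a b c d where pe: "p = ((a, b), (c, d))" and abcd: "(a, b) \<in> m" "(c, d) \<in> m"
    "a < c" "c < b" "b < d"
    using p unfolding crossings_def by blast
  have "b \<noteq> i" "b \<noteq> Suc i" "d \<noteq> i" "d \<noteq> Suc i"
    using consecutive_openers_not_closers[OF m i] abcd by auto
  then have "transpose i (Suc i) a < transpose i (Suc i) c"
    "transpose i (Suc i) c < transpose i (Suc i) b"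
    "transpose i (Suc i) b < transpose i (Suc i) d"
    using abcd p(2) transpose_Suc_less_iff[of a i c] transpose_Suc_less_iff[of c i b]
      transpose_Suc_less_iff[of b i d]
    by (auto simp: pe)
  then show ?thesis
    using abcd by (auto simp: pe swap_pairs_def crossings_def mem_swap_openers_iff)
qed

lemma swap_pairs_nestings:
  assumes m: "m \<in> perfect_matchings V" and i: "consecutive_openers m i"
    and p: "p \<in> nestings m" "\<not> (fst (fst p) = i \<and> fst (snd p) = Suc i)"
  shows "swap_pairs i p \<in> nestings (swap_openers i m)"
proof -
  obtain a b c d where pe: "p = ((a, b), (c, d))" and abcd: "(a, b) \<in> m" "(c, d) \<in> m"
    "a < c" "c < d" "d < b"
    using p unfolding nestings_def by blast
  have "b \<noteq> i" "b \<noteq> Suc i" "d \<noteq> i" "d \<noteq> Suc i"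
    using consecutive_openers_not_closers[OF m i] abcd by auto
  then have "transpose i (Suc i) a < transpose i (Suc i) c"
    "transpose i (Suc i) c < transpose i (Suc i) d"
    "transpose i (Suc i) d < transpose i (Suc i) b"
    using abcd p(2) transpose_Suc_less_iff[of a i c] transpose_Suc_less_iff[of c i d]
      transpose_Suc_less_iff[of d i b]
    by (auto simp: pe)
  then show ?thesis
    using abcd by (auto simp: pe swap_pairs_def nestings_def mem_swap_openers_iff)
qed

lemma finite_crossings: "finite m \<Longrightarrow> finite (crossings m)"
  by (rule finite_subset[of _ "m \<times> m"]) (auto simp: crossings_def)

lemma finite_nestings: "finite m \<Longrightarrow> finite (nestings m)"
  by (rule finite_subset[of _ "m \<times> m"]) (auto simp: nestings_def)

text \<open>\<open>swap_pairs i\<close> is its own inverse, so mapping each set into the other makes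
  it a bijection.\<close>

lemma card_eq_by_swap_pairs:
  assumes "\<And>p. p \<in> S \<Longrightarrow> swap_pairs i p \<in> T" "\<And>p. p \<in> T \<Longrightarrow> swap_pairs i p \<in> S"
  shows "card S = card T"
  by (rule bij_betw_same_card[of "swap_pairs i"],
      rule bij_betw_byWitness[where f' = "swap_pairs i"]) (use assms in auto)

text \<open>For \<open>b < d\<close> the arcs at \<open>i\<close> and \<open>Suc i\<close> cross in
  \<open>m\<close> and nest after the exchange. With this pair of arcs set aside,
  \<open>swap_pairs i\<close> matches crossings with crossings and nestings with nestings.\<close>

lemma cross_nest_swap_openers:
  assumes V: "finite V" and m: "m \<in> perfect_matchings V"
    and b: "(i, b) \<in> m" and d: "(Suc i, d) \<in> m" and bd: "b < d"
  shows "cross m = Suc (cross (swap_openers i m))"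
    and "nest (swap_openers i m) = Suc (nest m)"
proof -
  let ?m = "swap_openers i m" and ?t = "transpose i (Suc i)"
  have i: "consecutive_openers m i"
    using b d by (force simp: consecutive_openers_def)
  note m' = swap_openers_perfect_matching[OF m i]
  have i': "consecutive_openers ?m i"
    using i by (simp add: consecutive_openers_swap_openers[OF m i])
  have "?t b = b" "?t d = d"
    using transpose_closer[OF m i] b d by auto
  then have b': "(Suc i, b) \<in> ?m" and d': "(i, d) \<in> ?m"
    using b d by (auto simp: mem_swap_openers_iff)
  \<comment> \<open>In \<open>m\<close> itself only \<open>i < b\<close> is immediate; the
    orientation of the exchanged arc gives the stronger bound.\<close>
  have ib: "Suc i < b" using perfect_matching_in_carrier(3)[OF m' b'] .
  have u: "z = b" if "(i, z) \<in> m" for z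
    using perfect_matching_unique[OF m b that] by simp
  have v: "z = d" if "(Suc i, z) \<in> m" for z
    using perfect_matching_unique[OF m d that] by simp
  have u': "z = b" if "(Suc i, z) \<in> ?m" for z
    using perfect_matching_unique[OF m' b' that] by simp
  have v': "z = d" if "(i, z) \<in> ?m" for z
    using perfect_matching_unique[OF m' d' that] by simp
  \<comment> \<open>The openers \<open>i\<close> and \<open>Suc i\<close> determine both arcs, so
    the case excluded for \<open>swap_pairs\<close> is a single pair of arcs: a crossing of
    \<open>m\<close>, a nesting of \<open>?m\<close>.\<close>
  have crossE: "p = ((i, b), (Suc i, d))"
    if "p \<in> crossings m" "fst (fst p) = i" "fst (snd p) = Suc i" for p
    using that u v by (auto simp: crossings_def)
  have cross'E: False
    if "p \<in> crossings ?m" "fst (fst p) = i" "fst (snd p) = Suc i" for p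
    using that u' v' bd by (fastforce simp: crossings_def)
  have nestE: False
    if "p \<in> nestings m" "fst (fst p) = i" "fst (snd p) = Suc i" for p
    using that u v bd by (fastforce simp: nestings_def)
  have nest'E: "p = ((i, d), (Suc i, b))"
    if "p \<in> nestings ?m" "fst (fst p) = i" "fst (snd p) = Suc i" for p
    using that u' v' by (auto simp: nestings_def)
  \<comment> \<open>A preimage would list the arc opening at \<open>Suc i\<close> before the one
    opening at \<open>i\<close>, against the order of openers in a crossing.\<close>
  have notC: "swap_pairs i p \<noteq> ((i, b), (Suc i, d))" if "p \<in> crossings ?m" for p
  proof
    assume "swap_pairs i p = ((i, b), (Suc i, d))"
    then have "p = swap_pairs i ((i, b), (Suc i, d))"
      by (metis swap_pairs_involutory)
    then show False using that by (simp add: swap_pairs_def crossings_def)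
  qed
  have notN: "swap_pairs i p \<noteq> ((i, d), (Suc i, b))" if "p \<in> nestings m" for p
  proof
    assume "swap_pairs i p = ((i, d), (Suc i, b))"
    then have "p = swap_pairs i ((i, d), (Suc i, b))"
      by (metis swap_pairs_involutory)
    then show False using that by (simp add: swap_pairs_def nestings_def)
  qed
  have back_crossing: "swap_pairs i p \<in> crossings m"
    if "p \<in> crossings ?m" "\<not> (fst (fst p) = i \<and> fst (snd p) = Suc i)" for p
    using swap_pairs_crossings[OF m' i' that] by simp
  have back_nesting: "swap_pairs i p \<in> nestings m"
    if "p \<in> nestings ?m" "\<not> (fst (fst p) = i \<and> fst (snd p) = Suc i)" for p
    using swap_pairs_nestings[OF m' i' that] by simp
  have "card (crossings m - {((i, b), (Suc i, d))}) = card (crossings ?m)"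
  proof (rule card_eq_by_swap_pairs)
    fix p assume "p \<in> crossings m - {((i, b), (Suc i, d))}"
    then show "swap_pairs i p \<in> crossings ?m"
      using swap_pairs_crossings[OF m i] crossE by blast
  next
    fix p assume "p \<in> crossings ?m"
    then show "swap_pairs i p \<in> crossings m - {((i, b), (Suc i, d))}"
      using back_crossing cross'E notC by blast
  qed
  moreover have "((i, b), (Suc i, d)) \<in> crossings m"
    using b d bd ib by (auto simp: crossings_def)
  ultimately have "card (crossings m) = Suc (card (crossings ?m))"
    using card.remove[OF finite_crossings[OF finite_perfect_matching[OF V m]]] by metis
  then show "cross m = Suc (cross ?m)"
    by (simp add: cross_def crossings_def)
  have "card (nestings ?m - {((i, d), (Suc i, b))}) = card (nestings m)"
  proof (rule card_eq_by_swap_pairs)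
    fix p assume "p \<in> nestings ?m - {((i, d), (Suc i, b))}"
    then show "swap_pairs i p \<in> nestings m"
      using back_nesting nest'E by blast
  next
    fix p assume "p \<in> nestings m"
    then show "swap_pairs i p \<in> nestings ?m - {((i, d), (Suc i, b))}"
      using swap_pairs_nestings[OF m i] nestE notN by blast
  qed
  moreover have "((i, d), (Suc i, b)) \<in> nestings ?m"
    using b' d' bd ib by (auto simp: nestings_def)
  ultimately have "card (nestings ?m) = Suc (card (nestings m))"
    using card.remove[OF finite_nestings[OF finite_perfect_matching[OF V m']]] by metis
  then show "nest ?m = Suc (nest m)"
    by (simp add: nest_def nestings_def)
qed

section \<open>Products over a matching\<close>

text \<open>Each pair is determined by its opener and also by its closer, so both projections are
  injective and the product splits.\<close>

lemma prod_perfect_matching: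
  fixes x y :: "nat \<Rightarrow> 'a::comm_monoid_mult"
  assumes m: "m \<in> perfect_matchings V"
  shows "(\<Prod>(a, b)\<in>m. x a * y b) = prod x (fst ` m) * prod y (snd ` m)"
proof -
  have "inj_on fst m" "inj_on snd m"
    using perfect_matching_unique[OF m] unfolding inj_on_def by (metis prod.collapse)+
  then have "prod x (fst ` m) = (\<Prod>p\<in>m. x (fst p))" "prod y (snd ` m) = (\<Prod>p\<in>m. y (snd p))"
    by (simp_all add: prod.reindex)
  then show ?thesis by (simp add: case_prod_beta prod.distrib)
qed

section \<open>The matching without consecutive openers\<close>

text \<open>Counting from 1 agrees with the index of the product in the theorem and keeps
  \<open>2 * k - 1\<close> from being truncated.\<close>

definition standard_matching :: "nat \<Rightarrow> (nat \<times> nat) set" where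
  "standard_matching n = (\<lambda>k. (2 * k - 1, 2 * k)) ` {1..n}"

lemma mem_standard_matching_iff:
  "(a, b) \<in> standard_matching n \<longleftrightarrow> odd a \<and> b = Suc a \<and> b \<le> 2 * n"
proof
  assume "odd a \<and> b = Suc a \<and> b \<le> 2 * n"
  then obtain k where "a = 2 * k + 1" "b = 2 * k + 2" "b \<le> 2 * n"
    by (auto elim!: oddE)
  then show "(a, b) \<in> standard_matching n"
    by (auto simp: standard_matching_def intro!: image_eqI[of _ _ "Suc k"])
qed (auto simp: standard_matching_def)

lemma standard_matching_perfect: "standard_matching n \<in> perfect_matchings {1..2 * n}"
proof -
  have "\<exists>!p. p \<in> standard_matching n \<and> (v = fst p \<or> v = snd p)" if v: "v \<in> {1..2 * n}" for v
  proof (cases "odd v")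
    case True
    then have "v \<noteq> 2 * n" by auto
    then have "Suc v \<le> 2 * n" using v by auto
    with True show ?thesis
      by (intro ex1I[of _ "(v, Suc v)"]) (auto simp: mem_standard_matching_iff)
  next
    case False
    then show ?thesis using v
      by (intro ex1I[of _ "(v - 1, v)"]) (auto simp: mem_standard_matching_iff)
  qed
  then show ?thesis
    unfolding perfect_matchings_def by (auto simp: mem_standard_matching_iff odd_pos Suc_leI)
qed

text \<open>All openers are odd.\<close>

lemma standard_matching_no_consecutive_openers: "\<not> consecutive_openers (standard_matching n) i"
  by (auto simp: consecutive_openers_def mem_standard_matching_iff)

text \<open>The arcs are forced from left to right: once the first \<open>k\<close> are known,
  \<open>2 * k + 1\<close> must open, then \<open>2 * k + 2\<close> must close, and only
  \<open>2 * k + 1\<close> is free to be its partner.\<close>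

lemma no_consecutive_openers_imp_standard:
  assumes m: "m \<in> perfect_matchings {1..2 * n}" and no: "\<nexists>i. consecutive_openers m i"
  shows "m = standard_matching n"
proof -
  note u = perfect_matching_unique[OF m]
  have mem: "(2 * k + 1, 2 * k + 2) \<in> m" if "k < n" for k
    using that
  proof (induction k rule: less_induct)
    case (less k)
    have IH: "(2 * j + 1, 2 * j + 2) \<in> m" if "j < k" for j
      using less that by simp
    \<comment> \<open>Vertices below \<open>2 * k\<close> already lie on arcs ending at most at
      \<open>2 * k\<close>. The vertex \<open>2 * k\<close> itself is treated separately, as the
      closer of the arc with index \<open>k - 1\<close>.\<close>
    have earlier: "w \<ge> 2 * k" if w: "(a, w) \<in> m \<or> (w, a) \<in> m" "1 \<le> w" "2 * k < a" for a w
    proof (rule ccontr)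
      assume "\<not> w \<ge> 2 * k"
      then have "\<exists>j<k. w = 2 * j + 1 \<or> w = 2 * j + 2" using w(2) by presburger
      then obtain j where j: "j < k" "w = 2 * j + 1 \<or> w = 2 * j + 2" by blast
      show False
        using u[OF IH[OF j(1)], of a w] u[OF IH[OF j(1)], of w a] w j by auto
    qed
    have pos: "1 \<le> a" if "(a, b) \<in> m" for a b
      using perfect_matching_in_carrier[OF m that] by simp
    have no_closer: "(a, 2 * k + 1) \<notin> m" for a
    proof
      assume a: "(a, 2 * k + 1) \<in> m"
      then have "a < 2 * k + 1" "1 \<le> a" using perfect_matching_in_carrier[OF m a] by auto
      moreover have "2 * k \<le> a" using earlier[of "2 * k + 1" a] a \<open>1 \<le> a\<close> by auto
      \<comment> \<open>Here \<open>a = 2 * k\<close>, and \<open>1 \<le> a\<close> gives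
        \<open>k > 0\<close>, so \<open>k - 1\<close> is a genuine predecessor and its arc already
        closes at \<open>a\<close>.\<close>
      ultimately have ak: "a = 2 * (k - 1) + 2" "k - 1 < k" by auto
      from u[OF IH[OF ak(2)] a] ak show False by auto
    qed
    then obtain b where b: "(2 * k + 1, b) \<in> m"
      using less.prems by (auto intro: perfect_matching_covers[OF m, of "2 * k + 1"])
    \<comment> \<open>The absence of consecutive openers enters here: \<open>2 * k + 1\<close> has
      just been shown to open.\<close>
    have "(2 * k + 2, c) \<notin> m" for c
      using no b by (force simp: consecutive_openers_def)
    then obtain a where a: "(a, 2 * k + 2) \<in> m"
      using less.prems by (auto intro: perfect_matching_covers[OF m, of "2 * k + 2"])
    have "a < 2 * k + 2" "2 * k \<le> a"
      using perfect_matching_in_carrier[OF m a] earlier[of "2 * k + 2" a] a by auto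
    moreover have "a \<noteq> 2 * k"
    proof
      assume "a = 2 * k"
      then have ak: "a = 2 * (k - 1) + 2" "k - 1 < k" using pos[OF a] by auto
      from u[OF IH[OF ak(2)] a] ak show False by auto
    qed
    ultimately have "a = 2 * k + 1" by simp
    then show ?case using a by simp
  qed
  have sub: "standard_matching n \<subseteq> m"
  proof
    fix p assume "p \<in> standard_matching n"
    then obtain k where "k \<in> {1..n}" "p = (2 * k - 1, 2 * k)"
      by (auto simp: standard_matching_def)
    then show "p \<in> m" using mem[of "k - 1"] by (cases k) auto
  qed
  \<comment> \<open>The standard arcs lie in \<open>m\<close> and already cover every vertex, so any
    arc of \<open>m\<close> shares a vertex with one of them and equals it.\<close>
  have "p \<in> standard_matching n" if "p \<in> m" for p
  proof -
    obtain a b where p: "p = (a, b)" by (cases p)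
    then have "a \<in> {1..2 * n}" using perfect_matching_in_carrier[OF m] that by blast
    then obtain w where "(a, w) \<in> standard_matching n \<or> (w, a) \<in> standard_matching n"
      using perfect_matching_covers[OF standard_matching_perfect] by blast
    then show ?thesis using u sub that p by blast
  qed
  with sub show ?thesis by blast
qed

text \<open>Arcs joining neighbours have no vertex strictly below them. The same reason excludes
  nestings.\<close>

lemma cross_standard_matching: "cross (standard_matching n) = 0"
proof -
  have empty: "crossings (standard_matching n) = {}"
    by (auto simp: crossings_def mem_standard_matching_iff)
  show ?thesis using empty unfolding cross_def crossings_def by (simp only: card.empty)
qed

lemma nest_standard_matching: "nest (standard_matching n) = 0"
proof -
  have empty: "nestings (standard_matching n) = {}"
    by (auto simp: nestings_def mem_standard_matching_iff)
  show ?thesis using empty unfolding nest_def nestings_def by (simp only: card.empty)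
qed

section \<open>Cancellation in the Pfaffian sum\<close>

theorem proposition5:
  fixes l :: "'a::comm_ring_1" and x y :: "nat \<Rightarrow> 'a" and n :: nat
  assumes "n > 0"
  shows "lambda_Pfaffian l n (\<lambda>i j. x i * y j) = (\<Prod>i=1..n. x (2 * i - 1) * y (2 * i))"
proof -
  let ?M = "perfect_matchings {1..2 * n}"
  \<comment> \<open>The least value is meaningful only if consecutive openers exist;
    \<open>C\<close> and \<open>N\<close> are restricted to such matchings.\<close>
  define first where "first m = (LEAST i. consecutive_openers m i)" for m
  define inv where "inv m = swap_openers (first m) m" for m
  define trm where "trm m = (- 1) ^ cross m * l ^ (cross m + nest m) * (\<Prod>(a, b)\<in>m. x a * y b)"
    for m
  \<comment> \<open>In \<open>C\<close> the two chosen arcs cross, in \<open>N\<close> they nest.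
    Comparing the two sums gives cancellation over any commutative ring, also where
    \<open>s = - s\<close> does not imply \<open>s = 0\<close>.\<close>
  define C where "C = {m \<in> ?M. (\<exists>i. consecutive_openers m i) \<and>
    (\<exists>b d. (first m, b) \<in> m \<and> (Suc (first m), d) \<in> m \<and> b < d)}"
  define N where "N = {m \<in> ?M. (\<exists>i. consecutive_openers m i) \<and>
    (\<exists>b d. (first m, b) \<in> m \<and> (Suc (first m), d) \<in> m \<and> d < b)}"
  have first: "consecutive_openers m (first m)" if "\<exists>i. consecutive_openers m i" for m
    using that unfolding first_def by (rule LeastI_ex)
  have inv: "inv m \<in> ?M" "first (inv m) = first m" "inv (inv m) = m"
    "\<exists>i. consecutive_openers (inv m) i"
    "\<And>b. (first m, b) \<in> m \<Longrightarrow> (Suc (first m), b) \<in> inv m"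
    "\<And>b. (Suc (first m), b) \<in> m \<Longrightarrow> (first m, b) \<in> inv m"
    if m: "m \<in> ?M" "\<exists>i. consecutive_openers m i" for m
  proof -
    note i = first[OF m(2)]
    note same = consecutive_openers_swap_openers[OF m(1) i]
    show "inv m \<in> ?M" unfolding inv_def by (rule swap_openers_perfect_matching[OF m(1) i])
    show fi: "first (inv m) = first m" using same by (simp add: inv_def first_def)
    show "inv (inv m) = m" using fi by (simp add: inv_def)
    show "\<exists>i. consecutive_openers (inv m) i" using same i by (auto simp: inv_def)
    show "(Suc (first m), b) \<in> inv m" if "(first m, b) \<in> m" for b
      using that transpose_closer[OF m(1) i that] by (simp add: inv_def mem_swap_openers_iff)
    show "(first m, b) \<in> inv m" if "(Suc (first m), b) \<in> m" for b
      using that transpose_closer[OF m(1) i that] by (simp add: inv_def mem_swap_openers_iff)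
  qed
  have fin: "finite ?M" by (simp add: finite_perfect_matchings)
  have "C \<subseteq> ?M" "N \<subseteq> ?M" by (auto simp: C_def N_def)
  then have finCN: "finite C" "finite N" using fin finite_subset by blast+
  have bij: "bij_betw inv C N"
  proof (rule bij_betw_byWitness[where f' = inv])
    show "inv ` C \<subseteq> N"
    proof (rule image_subsetI)
      fix m assume "m \<in> C"
      then obtain b d where m: "m \<in> ?M" "\<exists>i. consecutive_openers m i"
        and bd: "(first m, b) \<in> m" "(Suc (first m), d) \<in> m" "b < d"
        by (auto simp: C_def)
      have "(first m, d) \<in> inv m" "(Suc (first m), b) \<in> inv m"
        using inv(5,6)[OF m] bd by auto
      with inv(1,2,4)[OF m] bd(3) show "inv m \<in> N" unfolding N_def by auto
    qed
    show "inv ` N \<subseteq> C"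
    proof (rule image_subsetI)
      fix m assume "m \<in> N"
      then obtain b d where m: "m \<in> ?M" "\<exists>i. consecutive_openers m i"
        and bd: "(first m, b) \<in> m" "(Suc (first m), d) \<in> m" "d < b"
        by (auto simp: N_def)
      have "(first m, d) \<in> inv m" "(Suc (first m), b) \<in> inv m"
        using inv(5,6)[OF m] bd by auto
      with inv(1,2,4)[OF m] bd(3) show "inv m \<in> C" unfolding C_def by auto
    qed
  qed (use inv(3) in \<open>auto simp: C_def N_def\<close>)
  have "trm (inv m) = - trm m" if mC: "m \<in> C" for m
  proof -
    have m: "m \<in> ?M" "\<exists>i. consecutive_openers m i" using mC by (auto simp: C_def)
    obtain b d where bd: "(first m, b) \<in> m" "(Suc (first m), d) \<in> m" "b < d"
      using mC by (auto simp: C_def)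
    note i = first[OF m(2)]
    have "(\<Prod>(a, b)\<in>inv m. x a * y b) = (\<Prod>(a, b)\<in>m. x a * y b)"
      using prod_perfect_matching[OF inv(1)[OF m], of x y] prod_perfect_matching[OF m(1), of x y]
      by (simp add: inv_def openers_swap_openers[OF m(1) i] closers_swap_openers[OF m(1) i])
    \<comment> \<open>One crossing becomes one nesting: the sign changes while the exponent of
      \<open>l\<close> stays the same.\<close>
    moreover have "cross m = Suc (cross (inv m))" "nest (inv m) = Suc (nest m)"
      unfolding inv_def using cross_nest_swap_openers[OF _ m(1) bd] by auto
    ultimately show ?thesis by (simp add: trm_def)
  qed
  then have sumN: "sum trm N = - sum trm C"
    using sum.reindex_bij_betw[OF bij, of trm] by (simp add: sum_negf)
  have S: "standard_matching n \<in> ?M" by (rule standard_matching_perfect)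
  have "?M \<subseteq> insert (standard_matching n) (C \<union> N)"
  proof
    fix m assume m: "m \<in> ?M"
    show "m \<in> insert (standard_matching n) (C \<union> N)"
    proof (cases "\<exists>i. consecutive_openers m i")
      case True
      from first[OF True] obtain b d where bd: "(first m, b) \<in> m" "(Suc (first m), d) \<in> m"
        by (auto simp: consecutive_openers_def)
      \<comment> \<open>Distinct openers have distinct closers, so \<open>C\<close> and
        \<open>N\<close> exhaust the matchings with consecutive openers.\<close>
      then have "b \<noteq> d" using perfect_matching_unique[OF m bd] by auto
      then have "b < d \<or> d < b" by auto
      then show ?thesis using m True bd unfolding C_def N_def by blast
    next
      case False
      then show ?thesis using no_consecutive_openers_imp_standard[OF m] by auto
    qed
  qed
  with \<open>C \<subseteq> ?M\<close> \<open>N \<subseteq> ?M\<close> S have M: "?M = insert (standard_matching n) (C \<union> N)" by blast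
  have notin: "standard_matching n \<notin> C \<union> N"
    using standard_matching_no_consecutive_openers by (auto simp: C_def N_def)
  have disj: "C \<inter> N = {}"
  proof -
    have False if CN: "m \<in> C" "m \<in> N" for m
    proof -
      obtain b d b' d' where "m \<in> ?M" "(first m, b) \<in> m" "(Suc (first m), d) \<in> m" "b < d"
        "(first m, b') \<in> m" "(Suc (first m), d') \<in> m" "d' < b'"
        using CN unfolding C_def N_def by blast
      then show False
        using perfect_matching_unique[of m "{1..2 * n}" "first m" b "first m" b']
          perfect_matching_unique[of m "{1..2 * n}" "Suc (first m)" d "Suc (first m)" d'] by auto
    qed
    then show ?thesis by blast
  qed
  have "lambda_Pfaffian l n (\<lambda>i j. x i * y j) = sum trm ?M"
    by (simp add: lambda_Pfaffian_def trm_def)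
  also have "\<dots> = trm (standard_matching n) + (sum trm C + sum trm N)"
    unfolding M using notin finCN disj by (simp add: sum.union_disjoint)
  also have "\<dots> = trm (standard_matching n)" by (simp add: sumN)
  also have "\<dots> = (\<Prod>(a, b)\<in>standard_matching n. x a * y b)"
    by (simp add: trm_def cross_standard_matching nest_standard_matching)
  also have "\<dots> = (\<Prod>i=1..n. x (2 * i - 1) * y (2 * i))"
    unfolding standard_matching_def by (subst prod.reindex) (auto intro!: inj_onI)
  finally show ?thesis .
qed

end
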